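(* Let $\alpha\in[1,2]$ and $c>0$, let $X_1,X_2,\dots$ be i.i.d. real random variables with the symmetric stable law of index $\alpha$, i.e. with characteristic function $\varphi(t)=e^{-c|t|^{\alpha}}$, $t\in\mathbb{R}$, and let $S_n=X_1+\cdots+X_n$ for $n\ge1$. Let $\varepsilon\ge0$. Then (i) if $\varepsilon\le 1-\frac1\alpha$, then $K\big((n^{\varepsilon}S_n)_{n\ge1}\big)=\overline{\mathbb{R}}$ almost surely; (ii) if $\varepsilon>1-\frac1\alpha$, then $K\big((n^{\varepsilon}S_n)_{n\ge1}\big)=\{-\infty,+\infty\}$ almost surely.
   Context: $\overline{\mathbb{R}}:=\mathbb{R}\cup\{-\infty,+\infty\}$ with its usual topology. For a sequence $x=(x_n)_{n\ge1}$ of real numbers, $K(x)$ is the set of all $a\in\overline{\mathbb{R}}$ that are accumulation points of $(x_n)_{n\ge1}$, i.e. such that every neighborhood of $a$ contains $x_n$ for infinitely many indices $n$. *)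

theory Defs
  imports "HOL-Probability.Probability"
begin

text \<open>
  The accumulation points, in the extended real line with its order topology, of a real sequence
  indexed by \<open>n \<ge> 1\<close>.  Infinitely many \<^emph>\<open>indices\<close> are required, not infinitely many values,
  so this is not \<open>islimpt\<close> of the range of the sequence.
\<close>

definition accum_pts :: "(nat \<Rightarrow> real) \<Rightarrow> ereal set"
  where "accum_pts x =
    {a. \<forall>U. open U \<and> a \<in> U \<longrightarrow> infinite {n. 1 \<le> n \<and> ereal (x n) \<in> U}}"

end

theory Submission
  imports Defs "HOL-Real_Asymp.Real_Asymp"
begin

text \<open>
  Levy's inversion formula shows that the stable law charges an interval \<open>{a<..b}\<close> with at most
  \<open>C * (b - a)\<close>, and with at least \<open>\<kappa> * (b - a)\<close> near the origin.  As \<open>S\<^sub>k - S\<^sub>j\<close> is distributed as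
  \<open>(k - j) powr (1 / \<alpha>)\<close> times a single step, the events \<open>n powr \<epsilon> * S\<^sub>n \<in> I\<close>, for a fixed bounded
  interval \<open>I\<close>, have probability of order \<open>n powr - \<gamma>\<close> with \<open>\<gamma> = \<epsilon> + 1 / \<alpha>\<close>.

  If \<open>\<gamma> \<le> 1\<close>, decompose the expected number of visits to \<open>I\<close> between times \<open>n\<close> and \<open>N\<close>
  according to the first visit: given any event of the past of \<open>n\<close>, a visit takes place with
  probability at least \<open>q > 0\<close>, where \<open>q\<close> depends neither on \<open>n\<close> nor on the event.  Such a uniform
  bound forces infinitely many visits almost surely, so no zero-one law is needed.  If \<open>\<gamma> > 1\<close>, the
  first Borel-Cantelli lemma gives \<open>\<bar>n powr \<epsilon> * S\<^sub>n\<bar> \<rightarrow> \<infinity>\<close>, and both signs recur because the events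
  \<open>S\<^sub>n > 0\<close> and \<open>S\<^sub>n \<le> 0\<close> satisfy a uniform bound of the same kind.
\<close>

subsection \<open>Interval probabilities from an integrable characteristic function\<close>

text \<open>Levy inversion gives the mass of \<open>{a<..b}\<close> as the limit of
  \<open>1 / (2 * pi)\<close> times truncated integrals of a kernel \<open>F\<close> against
  \<open>f\<close>. The estimate \<open>norm (F t) \<le> b - a\<close> yields the upper bound. For
  the lower one, \<open>f\<close> is real, so only \<open>Re (F t)\<close> counts; near the origin
  it is close to \<open>b - a\<close>, with an error controlled by the first absolute moment of
  \<open>f\<close>.\<close>

lemma (in real_distribution) cdf_increment_bounds_nonatomic:
  fixes f :: "real \<Rightarrow> real" and m r a b :: real
  assumes char_f: "\<And>t. char M t = complex_of_real (f t)"
    and f_nonneg: "\<And>t. 0 \<le> f t"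
    and f_int: "integrable lborel f"
    and f_mom: "integrable lborel (\<lambda>t. \<bar>t\<bar> * f t)"
    and f_lb: "\<And>t. \<bar>t\<bar> \<le> 1 \<Longrightarrow> m \<le> f t"
    and ab: "a \<le> b" and nonatomic: "measure M {a} = 0" "measure M {b} = 0"
  shows "measure M {a<..b} \<le> (b - a) * ((\<integral>t. f t \<partial>lborel) / (2 * pi))"
    and "\<lbrakk>-r \<le> a; b \<le> r; 0 \<le> r; r * (\<integral>t. \<bar>t\<bar> * f t \<partial>lborel) \<le> m\<rbrakk>
      \<Longrightarrow> (b - a) * (m / (2 * pi)) \<le> measure M {a<..b}"
proof -
  define F where "F = (\<lambda>t. (iexp (-(t * a)) - iexp (-(t * b))) / (\<i> * complex_of_real t))"
  define g where "g = (\<lambda>T t. indicat_real {- real T..real T} t *\<^sub>R (F t * complex_of_real (f t)))"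
  define J where "J = (\<lambda>T. \<integral>t. g T t \<partial>lborel)"
  have f_meas [measurable]: "f \<in> borel_measurable borel"
    using borel_measurable_integrable[OF f_int] by simp
  have [measurable]: "F \<in> borel_measurable borel" unfolding F_def by measurable
  have [measurable]: "g T \<in> borel_measurable borel" for T unfolding g_def by measurable
  have lim: "(\<lambda>T. 1 / (2 * pi) * J T) \<longlonglongrightarrow> complex_of_real (measure M {a<..b})"
    using Levy_Inversion[OF ab nonatomic]
    by (simp add: J_def g_def F_def char_f interval_integral_Icc set_lebesgue_integral_def)
  have Fn: "norm (F t) \<le> b - a" for t
    using Levy_Inversion_aux2[of "-b" "-a" t] ab by (cases "t = 0") (auto simp: F_def)
  have gn: "norm (g T t) \<le> (b - a) * f t" for T t
    using Fn[of t] ab f_nonneg[of t]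
    by (auto simp: g_def norm_mult indicator_def intro!: mult_right_mono)
  have gint: "integrable lborel (g T)" for T
    by (rule Bochner_Integration.integrable_bound[of _ "\<lambda>t. (b - a) * f t"])
       (use f_int gn ab f_nonneg in \<open>auto simp: abs_mult\<close>)
  have Jn: "norm (J T) \<le> (b - a) * (\<integral>t. f t \<partial>lborel)" for T
    using Bochner_Integration.integral_norm_bound_integral[OF gint, of "\<lambda>t. (b - a) * f t"] f_int gn
    by (simp add: J_def)
  have "(\<lambda>T. norm (1 / (2 * pi) * J T)) \<longlonglongrightarrow> measure M {a<..b}"
    using tendsto_norm[OF lim] unfolding norm_of_real abs_of_nonneg[OF measure_nonneg] .
  then show "measure M {a<..b} \<le> (b - a) * ((\<integral>t. f t \<partial>lborel) / (2 * pi))"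
    by (rule LIMSEQ_le_const2)
       (use Jn in \<open>auto simp: norm_mult norm_divide divide_simps\<close>)
  assume r: "-r \<le> a" "b \<le> r" "0 \<le> r" "r * (\<integral>t. \<bar>t\<bar> * f t \<partial>lborel) \<le> m"
  \<comment> \<open>The mean value theorem turns the difference of sines into
    \<open>(b - a) * (t * cos (t * z))\<close>, and this cosine differs from 1 by at most
    \<open>r\<close> times the modulus of \<open>t\<close>. Division by zero makes
    \<open>F 0 = 0\<close>, so \<open>t = 0\<close> is left out here and discarded later as a null
    set.\<close>
  have ReF: "(b - a) * (1 - r * \<bar>t\<bar>) \<le> Re (F t)" if "t \<noteq> 0" for t
  proof -
    have Re_eq: "Re (F t) = (sin (t * b) - sin (t * a)) / t"
      using that by (simp add: F_def Re_divide complex_eq_iff Re_exp Im_exp power2_eq_square)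
    show ?thesis
    proof (cases "a = b")
      case False
      then have "a < b" using ab by simp
      have "\<exists>z>a. z < b \<and> sin (t * b) - sin (t * a) = (b - a) * (t * cos (t * z))"
        using \<open>a < b\<close> by (intro MVT2) (auto intro!: derivative_eq_intros simp: mult.commute)
      then obtain z where z: "a < z" "z < b" "sin (t * b) - sin (t * a) = (b - a) * (t * cos (t * z))"
        by blast
      have "\<bar>cos (t * z) - cos 0\<bar> \<le> \<bar>t * z - 0\<bar>"
        using field_differentiable_bound[of UNIV cos "\<lambda>x. - sin x" 1 "t * z" "0::real"]
        by (auto intro!: derivative_eq_intros)
      moreover have "\<bar>t * z\<bar> \<le> r * \<bar>t\<bar>"
        using z r by (subst abs_mult, subst mult.commute) (intro mult_right_mono, auto)
      ultimately have "1 - r * \<bar>t\<bar> \<le> cos (t * z)" by simp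
      then show ?thesis using Re_eq z that ab by (simp add: mult_left_mono)
    qed (simp add: Re_eq)
  qed
  have ReJ: "(b - a) * m \<le> Re (J T)" if "1 \<le> T" for T
  proof -
    \<comment> \<open>The factor 2 is the length of \<open>{-1..1}\<close>, where \<open>f\<close>
      is at least \<open>m\<close>; the condition on \<open>r\<close> lets the moment term cost at
      most one \<open>m\<close>.\<close>
    have "(b - a) * m \<le> (b - a) * (m * 2 - r * (\<integral>t. \<bar>t\<bar> * f t \<partial>lborel))"
      using r ab by (intro mult_left_mono) auto
    also have "\<dots> = (\<integral>t. (b - a) * (m * indicator {-1..1} t - r * (\<bar>t\<bar> * f t)) \<partial>lborel)"
      using f_mom by (simp add: Bochner_Integration.integral_diff)
    also have "\<dots> \<le> (\<integral>t. Re (g T t) \<partial>lborel)"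
    proof (intro integral_mono_AE)
      show "integrable lborel (\<lambda>t. (b - a) * (m * indicator {-1..1} t - r * (\<bar>t\<bar> * f t)))"
        using f_mom by (intro integrable_mult_right Bochner_Integration.integrable_diff) auto
      show "integrable lborel (\<lambda>t. Re (g T t))" using gint by simp
      have "(b - a) * (m * indicator {-1..1} t - r * (\<bar>t\<bar> * f t)) \<le> Re (g T t)" if "t \<noteq> 0" for t
      proof (cases "\<bar>t\<bar> \<le> real T")
        case True
        have "m * indicator {-1..1} t \<le> f t"
          using f_lb[of t] f_nonneg[of t] by (auto simp: indicator_def)
        then have "(b - a) * (m * indicator {-1..1} t - r * (\<bar>t\<bar> * f t)) 
            \<le> (b - a) * (f t - r * (\<bar>t\<bar> * f t))"
          using ab by (intro mult_left_mono) auto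
        also have "\<dots> = (b - a) * (1 - r * \<bar>t\<bar>) * f t" by (simp add: algebra_simps)
        also have "\<dots> \<le> Re (F t) * f t" using ReF[OF that] f_nonneg by (intro mult_right_mono)
        finally show ?thesis using True by (auto simp: g_def indicator_def)
      next
        \<comment> \<open>Outside the truncation window \<open>g T t\<close> is 0; since
          \<open>1 \<le> T\<close>, the indicator vanishes there too and the comparison function is
          nonpositive.\<close>
        case False
        then have "\<not> \<bar>t\<bar> \<le> 1" using \<open>1 \<le> T\<close> by auto
        then show ?thesis using False r ab f_nonneg[of t]
          by (auto simp: g_def indicator_def intro!: mult_nonneg_nonneg)
      qed
      then show "AE t in lborel. (b - a) * (m * indicator {-1..1} t - r * (\<bar>t\<bar> * f t)) \<le> Re (g T t)"
        by (intro AE_I[of _ _ "{0}"]) auto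
    qed
    also have "\<dots> = Re (J T)" using gint by (simp add: J_def)
    finally show ?thesis .
  qed
  have "(\<lambda>T. Re (1 / (2 * pi) * J T)) \<longlonglongrightarrow> measure M {a<..b}"
    using tendsto_Re[OF lim] unfolding Re_complex_of_real .
  then show "(b - a) * (m / (2 * pi)) \<le> measure M {a<..b}"
    by (intro LIMSEQ_le_const[of "\<lambda>T. Re (1 / (2 * pi) * J T)"])
       (use ReJ in \<open>auto simp: divide_simps Re_divide power2_eq_square intro!: exI[of _ 1]\<close>)
qed

text \<open>There are only countably many atoms, so every point lies strictly inside arbitrarily
  short intervals with non-atomic endpoints. The upper bound on those intervals shows that no point
  is an atom, and the restriction on endpoints disappears.\<close>

lemma (in real_distribution) cdf_increment_bounds:
  fixes f :: "real \<Rightarrow> real" and m r a b :: real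
  assumes char_f: "\<And>t. char M t = complex_of_real (f t)"
    and f_nonneg: "\<And>t. 0 \<le> f t"
    and f_int: "integrable lborel f"
    and f_mom: "integrable lborel (\<lambda>t. \<bar>t\<bar> * f t)"
    and f_lb: "\<And>t. \<bar>t\<bar> \<le> 1 \<Longrightarrow> m \<le> f t"
    and ab: "a \<le> b"
  shows "measure M {a<..b} \<le> (b - a) * ((\<integral>t. f t \<partial>lborel) / (2 * pi))"
    and "\<lbrakk>-r \<le> a; b \<le> r; 0 \<le> r; r * (\<integral>t. \<bar>t\<bar> * f t \<partial>lborel) \<le> m\<rbrakk>
      \<Longrightarrow> (b - a) * (m / (2 * pi)) \<le> measure M {a<..b}"
proof -
  note nonatomic_bounds = cdf_increment_bounds_nonatomic[OF char_f f_nonneg f_int f_mom f_lb]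
  define C where "C = (\<integral>t. f t \<partial>lborel) / (2 * pi)"
  have C: "0 \<le> C" unfolding C_def using f_nonneg by auto
  have nonatom: "\<exists>z. u < z \<and> z < v \<and> measure M {z} = 0" if "u < v" for u v :: real
    using open_minus_countable[OF countable_support, of "{u<..<v}"] that by auto
  have atomless: "measure M {z} = 0" for z
  proof -
    have small: "measure M {z} \<le> 2 * C * e" if e: "e > 0" for e
    proof -
      obtain u where u: "z - e < u" "u < z" "measure M {u} = 0" using nonatom[of "z - e" z] e by auto
      obtain v where v: "z < v" "v < z + e" "measure M {v} = 0" using nonatom[of z "z + e"] e by auto
      have "measure M {z} \<le> measure M {u<..v}" using u v by (intro finite_measure_mono) auto
      also have "\<dots> \<le> (v - u) * C" using nonatomic_bounds(1)[of u v] u v C_def by auto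
      also have "\<dots> \<le> (2 * e) * C" using u v C by (intro mult_right_mono) auto
      finally show ?thesis by (simp add: mult_ac)
    qed
    have "measure M {z} \<le> 0"
    proof (rule field_le_epsilon)
      fix e :: real assume "e > 0"
      \<comment> \<open>The added 1 keeps the denominator positive when
        \<open>C = 0\<close>.\<close>
      then have "measure M {z} \<le> 2 * C * (e / (2 * C + 1))" using C by (intro small) auto
      also have "\<dots> \<le> e" using C \<open>e > 0\<close> by (simp add: divide_simps)
      finally show "measure M {z} \<le> 0 + e" by simp
    qed
    then show ?thesis by (simp add: measure_le_0_iff)
  qed
  show "measure M {a<..b} \<le> (b - a) * ((\<integral>t. f t \<partial>lborel) / (2 * pi))"
    by (rule nonatomic_bounds(1)[OF _ ab atomless atomless])
  show "(b - a) * (m / (2 * pi)) \<le> measure M {a<..b}"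
    if "-r \<le> a" "b \<le> r" "0 \<le> r" "r * (\<integral>t. \<bar>t\<bar> * f t \<partial>lborel) \<le> m"
    by (rule nonatomic_bounds(2)[OF _ ab atomless atomless that])
qed

subsection \<open>Recurrence of events in a filtration\<close>

text \<open>Fubini for the product law of \<open>U\<close> and \<open>D\<close>: with
  \<open>U\<close> frozen at \<open>u\<close>, the section is an event of \<open>D\<close> alone,
  and is empty when \<open>u\<close> lies outside \<open>B\<close>.\<close>

lemma (in prob_space) indep_var_sum_section:
  fixes N L :: "'b measure" and g h :: "'b \<Rightarrow> real"
  assumes indep: "indep_var N U L D"
    and B [measurable]: "B \<in> sets N" and g [measurable]: "g \<in> borel_measurable N"
    and h [measurable]: "h \<in> borel_measurable L"
    and I [measurable]: "I \<in> sets borel"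
  shows "ennreal (prob {\<omega> \<in> space M. U \<omega> \<in> B \<and> g (U \<omega>) + h (D \<omega>) \<in> I})
      = (\<integral>\<^sup>+u. ennreal (prob {\<omega> \<in> space M. g u + h (D \<omega>) \<in> I}) * indicator B u \<partial>distr M N U)"
proof -
  have U [measurable]: "U \<in> measurable M N" and D [measurable]: "D \<in> measurable M L"
    and joint: "distr M N U \<Otimes>\<^sub>M distr M L D = distr M (N \<Otimes>\<^sub>M L) (\<lambda>\<omega>. (U \<omega>, D \<omega>))"
    using indep unfolding indep_var_distribution_eq by auto
  interpret D: prob_space "distr M L D" by (rule prob_space_distr) simp
  define Q where "Q = {p \<in> space (N \<Otimes>\<^sub>M L). fst p \<in> B \<and> g (fst p) + h (snd p) \<in> I}"
  have Q [measurable]: "Q \<in> sets (N \<Otimes>\<^sub>M L)" unfolding Q_def by measurable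
  have "{\<omega> \<in> space M. U \<omega> \<in> B \<and> g (U \<omega>) + h (D \<omega>) \<in> I} = (\<lambda>\<omega>. (U \<omega>, D \<omega>)) -` Q \<inter> space M"
    using measurable_space[OF U] measurable_space[OF D] by (auto simp: Q_def space_pair_measure)
  then have "ennreal (prob {\<omega> \<in> space M. U \<omega> \<in> B \<and> g (U \<omega>) + h (D \<omega>) \<in> I})
      = emeasure (distr M (N \<Otimes>\<^sub>M L) (\<lambda>\<omega>. (U \<omega>, D \<omega>))) Q"
    by (subst emeasure_distr) (auto simp: emeasure_eq_measure)
  also have "\<dots> = (\<integral>\<^sup>+u. emeasure (distr M L D) (Pair u -` Q) \<partial>distr M N U)"
    by (subst joint[symmetric], rule D.emeasure_pair_measure_alt)
       (simp add: sets_pair_measure_cong[OF sets_distr sets_distr])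
  also have "\<dots> = (\<integral>\<^sup>+u. ennreal (prob {\<omega> \<in> space M. g u + h (D \<omega>) \<in> I}) * indicator B u \<partial>distr M N U)"
  proof (rule nn_integral_cong)
    fix u assume "u \<in> space (distr M N U)"
    then have u: "u \<in> space N" by simp
    have "Pair u -` Q = (if u \<in> B then {d \<in> space L. g u + h d \<in> I} else {})"
      using u by (auto simp: Q_def space_pair_measure)
    moreover have "emeasure (distr M L D) {d \<in> space L. g u + h d \<in> I}
        = ennreal (prob {\<omega> \<in> space M. g u + h (D \<omega>) \<in> I})"
      using measurable_space[OF D]
      by (subst emeasure_distr) (auto simp: emeasure_eq_measure intro!: arg_cong[where f = prob])
    ultimately show "emeasure (distr M L D) (Pair u -` Q)
        = ennreal (prob {\<omega> \<in> space M. g u + h (D \<omega>) \<in> I}) * indicator B u"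
      by auto
  qed
  finally show ?thesis .
qed

text \<open>This replaces conditioning on \<open>U\<close>: a bound valid from each frozen state in
  \<open>B\<close> becomes a factor \<open>p\<close> after integration over
  \<open>B\<close>.\<close>

lemma (in prob_space) indep_var_sum_bounds:
  fixes N L :: "'b measure" and g h :: "'b \<Rightarrow> real"
  assumes indep: "indep_var N U L D"
    and B [measurable]: "B \<in> sets N" and g [measurable]: "g \<in> borel_measurable N"
    and h [measurable]: "h \<in> borel_measurable L"
    and I [measurable]: "I \<in> sets borel"
    and p: "0 \<le> p"
  shows "(\<And>u. u \<in> B \<Longrightarrow> prob {\<omega> \<in> space M. g u + h (D \<omega>) \<in> I} \<le> p) \<Longrightarrow>
      prob {\<omega> \<in> space M. U \<omega> \<in> B \<and> g (U \<omega>) + h (D \<omega>) \<in> I} \<le> prob {\<omega> \<in> space M. U \<omega> \<in> B} * p"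
    and "(\<And>u. u \<in> B \<Longrightarrow> p \<le> prob {\<omega> \<in> space M. g u + h (D \<omega>) \<in> I}) \<Longrightarrow>
      prob {\<omega> \<in> space M. U \<omega> \<in> B} * p \<le> prob {\<omega> \<in> space M. U \<omega> \<in> B \<and> g (U \<omega>) + h (D \<omega>) \<in> I}"
proof -
  have U [measurable]: "U \<in> measurable M N"
    using indep unfolding indep_var_distribution_eq by auto
  have const: "(\<integral>\<^sup>+u. ennreal p * indicator B u \<partial>distr M N U) = ennreal (prob {\<omega> \<in> space M. U \<omega> \<in> B} * p)"
    using p by (simp add: nn_integral_cmult_indicator emeasure_distr emeasure_eq_measure
        vimage_def Int_def ennreal_mult mult.commute conj_commute)
  note section_eq = indep_var_sum_section[OF indep B g h I]
  show "prob {\<omega> \<in> space M. U \<omega> \<in> B \<and> g (U \<omega>) + h (D \<omega>) \<in> I} \<le> prob {\<omega> \<in> space M. U \<omega> \<in> B} * p"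
    if "\<And>u. u \<in> B \<Longrightarrow> prob {\<omega> \<in> space M. g u + h (D \<omega>) \<in> I} \<le> p"
  proof -
    have "ennreal (prob {\<omega> \<in> space M. U \<omega> \<in> B \<and> g (U \<omega>) + h (D \<omega>) \<in> I})
        \<le> (\<integral>\<^sup>+u. ennreal p * indicator B u \<partial>distr M N U)"
      unfolding section_eq
      by (intro nn_integral_mono) (auto simp: indicator_def intro!: ennreal_leI that)
    then show ?thesis unfolding const using p by (simp add: ennreal_le_iff)
  qed
  show "prob {\<omega> \<in> space M. U \<omega> \<in> B} * p \<le> prob {\<omega> \<in> space M. U \<omega> \<in> B \<and> g (U \<omega>) + h (D \<omega>) \<in> I}"
    if "\<And>u. u \<in> B \<Longrightarrow> p \<le> prob {\<omega> \<in> space M. g u + h (D \<omega>) \<in> I}"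
  proof -
    have "(\<integral>\<^sup>+u. ennreal p * indicator B u \<partial>distr M N U)
        \<le> ennreal (prob {\<omega> \<in> space M. U \<omega> \<in> B \<and> g (U \<omega>) + h (D \<omega>) \<in> I})"
      unfolding section_eq
      by (intro nn_integral_mono) (auto simp: indicator_def intro!: ennreal_leI that)
    then show ?thesis unfolding const using p by (simp add: ennreal_le_iff)
  qed
qed

text \<open>Continuity from below along integer cut-offs; if \<open>prob G\<close> is positive, its
  half lies strictly below the limit.\<close>

lemma (in prob_space) half_mass_bounded:
  fixes Z :: "'a \<Rightarrow> real"
  assumes [measurable]: "Z \<in> borel_measurable M" "G \<in> events"
  obtains R where "prob G / 2 \<le> prob (G \<inter> {\<omega> \<in> space M. \<bar>Z \<omega>\<bar> \<le> R})"
proof (cases "prob G = 0")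
  case True
  then show ?thesis by (intro that[of 0]) simp
next
  case False
  let ?A = "\<lambda>n::nat. G \<inter> {\<omega> \<in> space M. \<bar>Z \<omega>\<bar> \<le> real n}"
  have "(\<lambda>n. prob (?A n)) \<longlonglongrightarrow> prob (\<Union>n. ?A n)"
    by (intro finite_Lim_measure_incseq) (auto simp: incseq_def)
  moreover have "(\<Union>n. ?A n) = G"
    using sets.sets_into_space[OF assms(2)] by (auto intro: real_arch_simple)
  ultimately have "(\<lambda>n. prob (?A n)) \<longlonglongrightarrow> prob G" by simp
  moreover have "prob G / 2 < prob G" using False by (simp add: zero_less_measure_iff)
  ultimately have "eventually (\<lambda>n. prob G / 2 < prob (?A n)) sequentially"
    by (rule order_tendstoD)
  then obtain n where "prob G / 2 < prob (?A n)" by (auto simp: eventually_sequentially)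
  then show ?thesis by (intro that[of "real n"]) simp
qed

section \<open>Filtrations and uniform hitting bounds\<close>

locale filtered_prob_space = prob_space M for M :: "'a measure" +
  fixes F :: "nat \<Rightarrow> 'a measure"
  assumes space_F: "space (F n) = space M"
    and F_events: "H \<in> sets (F n) \<Longrightarrow> H \<in> events"
    and F_mono: "\<lbrakk>m \<le> n; H \<in> sets (F m)\<rbrakk> \<Longrightarrow> H \<in> sets (F n)"
begin

text \<open>
  A substitute for a zero-one law.  Let \<open>E m n\<close> be the event that no \<open>A k\<close> with \<open>m \<le> k \<le> n\<close> occurs.
  Failing again after time \<open>n\<close> costs a factor \<open>1 - q\<close>, so the probability \<open>p\<close> of never hitting after
  time \<open>m\<close> is at most \<open>(1 - q) * prob (E m n)\<close>; letting \<open>n\<close> tend to infinity, \<open>p \<le> (1 - q) * p\<close>.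
\<close>

lemma AE_infinitely_often:
  assumes A: "\<And>n. A n \<in> sets (F n)" and q: "0 < q"
    and hit: "\<And>n G. G \<in> sets (F n) \<Longrightarrow> q * prob G \<le> prob (G \<inter> (\<Union>k\<in>{n<..}. A k))"
  shows "AE \<omega> in M. infinite {n. \<omega> \<in> A n}"
proof -
  have A_events [measurable]: "A n \<in> events" for n using A F_events by blast
  define E where "E = (\<lambda>m n. space M - (\<Union>k\<in>{m..n}. A k))"
  have E_F: "E m n \<in> sets (F n)" for m n
    unfolding E_def space_F[of n, symmetric]
    by (intro sets.Diff sets.top sets.finite_UN) (auto intro: F_mono[OF _ A])
  have E_events [measurable]: "E m n \<in> events" for m n using E_F F_events by blast
  have null: "prob (\<Inter>n. E m n) = 0" for m
  proof -
    let ?p = "prob (\<Inter>n. E m n)"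
    have "?p \<le> (1 - q) * prob (E m n)" if "m \<le> n" for n
    proof -
      let ?U = "\<Union>k\<in>{n<..}. A k"
      have "?p \<le> prob (E m n - (E m n \<inter> ?U))"
      proof (intro finite_measure_mono subsetI)
        fix \<omega> assume \<omega>: "\<omega> \<in> (\<Inter>n. E m n)"
        have "\<omega> \<notin> A k" if "n < k" for k
          using \<omega> \<open>m \<le> n\<close> that unfolding E_def by force
        then show "\<omega> \<in> E m n - (E m n \<inter> ?U)" using \<omega> by auto
      qed measurable
      also have "\<dots> = prob (E m n) - prob (E m n \<inter> ?U)"
        by (intro finite_measure_Diff) auto
      also have "\<dots> \<le> (1 - q) * prob (E m n)" using hit[OF E_F, of m n] by (simp add: algebra_simps)
      finally show ?thesis .
    qed
    moreover have "(\<lambda>n. prob (E m n)) \<longlonglongrightarrow> ?p"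
      by (intro finite_Lim_measure_decseq) (auto simp: decseq_def E_def)
    then have "(\<lambda>n. (1 - q) * prob (E m n)) \<longlonglongrightarrow> (1 - q) * ?p" by (intro tendsto_intros)
    ultimately have "?p \<le> (1 - q) * ?p" by (intro LIMSEQ_le_const) auto
    then have "q * ?p \<le> 0" by (simp add: algebra_simps)
    then show "?p = 0" using q by (simp add: mult_le_0_iff measure_le_0_iff)
  qed
  have "AE \<omega> in M. \<omega> \<notin> (\<Inter>n. E m n)" for m
    using null[of m] by (intro AE_not_in) (simp add: null_sets_def emeasure_eq_measure)
  then have "AE \<omega> in M. \<forall>m. \<omega> \<notin> (\<Inter>n. E m n)"
    unfolding AE_all_countable by blast
  then show ?thesis
  proof (rule AE_mp, intro AE_I2 impI)
    fix \<omega> assume \<omega>: "\<omega> \<in> space M" and not_E: "\<forall>m. \<omega> \<notin> (\<Inter>n. E m n)"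
    show "infinite {n. \<omega> \<in> A n}"
      unfolding infinite_nat_iff_unbounded_le
    proof
      fix m
      obtain n where "\<omega> \<notin> E m n" using not_E by auto
      then show "\<exists>n\<ge>m. n \<in> {n. \<omega> \<in> A n}" using \<omega> by (auto simp: E_def)
    qed
  qed
qed

text \<open>
  Decompose according to the first hit: after it, the expected number of further hits is at most
  \<open>\<Sum>i. b i\<close>.
\<close>

lemma sum_hits_le:
  assumes A: "\<And>n. A n \<in> sets (F n)"
    and b: "\<And>i. 0 \<le> b i"
    and step: "\<And>j k H. \<lbrakk>j < k; H \<in> sets (F j)\<rbrakk> \<Longrightarrow> prob (H \<inter> A k) \<le> prob H * b (k - j)"
    and G: "G \<in> sets (F n)"
  shows "(\<Sum>k\<in>{n<..n+d}. prob (G \<inter> A k))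
      \<le> prob (G \<inter> (\<Union>k\<in>{n<..n+d}. A k)) * (1 + (\<Sum>i=1..d. b i))"
  using G
\<comment> \<open>The first hit is located one time at a time. \<open>G\<close> splits into
  \<open>G1\<close>, hit at \<open>Suc n\<close>, and \<open>G2\<close>, not hit there. On
  \<open>G1\<close> the gap bound controls all later hits; on \<open>G2\<close> the induction
  hypothesis restarts at \<open>Suc n\<close>, so \<open>n\<close> and \<open>G\<close> must
  vary.\<close>
proof (induction d arbitrary: n G)
  case 0
  then show ?case by simp
next
  case (Suc d)
  have A_events [measurable]: "A n \<in> events" for n using A F_events by blast
  have [measurable]: "G \<in> events" using Suc.prems F_events by blast
  define W where "W = 1 + (\<Sum>i=1..Suc d. b i)"
  define G1 where "G1 = G \<inter> A (Suc n)"
  define G2 where "G2 = G - A (Suc n)"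
  define V where "V = (\<Union>k\<in>{Suc n<..Suc n+d}. A k)"
  have [measurable]: "V \<in> events" unfolding V_def by measurable
  have G_Suc: "G \<in> sets (F (Suc n))" using F_mono[OF _ Suc.prems, of "Suc n"] by simp
  have G1: "G1 \<in> sets (F (Suc n))" and G2: "G2 \<in> sets (F (Suc n))"
    unfolding G1_def G2_def using G_Suc A by auto
  have [measurable]: "G1 \<in> events" "G2 \<in> events" using G1 G2 F_events by blast+
  have idx: "{n<..n + Suc d} = insert (Suc n) {Suc n<..Suc n + d}" by auto
  have "prob (G \<inter> A k) = prob (G1 \<inter> A k) + prob (G2 \<inter> A k)" for k
  proof -
    have "G \<inter> A k = (G1 \<inter> A k) \<union> (G2 \<inter> A k)" by (auto simp: G1_def G2_def)
    then show ?thesis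
      by (simp only:) (rule finite_measure_Union, auto simp: G1_def G2_def)
  qed
  then have "(\<Sum>k\<in>{Suc n<..Suc n+d}. prob (G \<inter> A k))
      = (\<Sum>k\<in>{Suc n<..Suc n+d}. prob (G1 \<inter> A k)) + (\<Sum>k\<in>{Suc n<..Suc n+d}. prob (G2 \<inter> A k))"
    by (simp only: sum.distrib)
  then have "(\<Sum>k\<in>{n<..n + Suc d}. prob (G \<inter> A k)) = prob G1
      + (\<Sum>k\<in>{Suc n<..Suc n+d}. prob (G1 \<inter> A k)) + (\<Sum>k\<in>{Suc n<..Suc n+d}. prob (G2 \<inter> A k))"
    unfolding idx by (subst sum.insert) (simp_all add: G1_def)
  also have "(\<Sum>k\<in>{Suc n<..Suc n+d}. prob (G1 \<inter> A k)) \<le> (\<Sum>k\<in>{Suc n<..Suc n+d}. prob G1 * b (k - Suc n))"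
    by (intro sum_mono step G1) auto
  also have "\<dots> = prob G1 * (\<Sum>i=1..d. b i)"
    unfolding sum_distrib_left
    by (rule sum.reindex_bij_witness[of _ "\<lambda>i. i + Suc n" "\<lambda>k. k - Suc n"]) auto
  also have "(\<Sum>k\<in>{Suc n<..Suc n+d}. prob (G2 \<inter> A k)) \<le> prob (G2 \<inter> V) * (1 + (\<Sum>i=1..d. b i))"
    unfolding V_def by (rule Suc.IH[OF G2])
  also have "prob G1 + prob G1 * (\<Sum>i=1..d. b i) + prob (G2 \<inter> V) * (1 + (\<Sum>i=1..d. b i))
      = (prob G1 + prob (G2 \<inter> V)) * (1 + (\<Sum>i=1..d. b i))" by (simp add: algebra_simps)
  also have "\<dots> \<le> (prob G1 + prob (G2 \<inter> V)) * W"
    unfolding W_def using b by (intro mult_left_mono) auto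
  also have "prob G1 + prob (G2 \<inter> V) = prob (G1 \<union> (G2 \<inter> V))"
    by (subst finite_measure_Union) (auto simp: G1_def G2_def)
  also have "G1 \<union> (G2 \<inter> V) = G \<inter> (\<Union>k\<in>{n<..n + Suc d}. A k)"
    unfolding idx V_def G1_def G2_def by auto
  finally show ?case by (simp add: W_def)
qed

end

subsection \<open>Increments of the stable random walk\<close>

text \<open>Both integrands are dominated by a multiple of \<open>inverse (1 + t\<^sup>2)\<close>.
  As \<open>1 \<le> \<alpha>\<close> gives \<open>s \<le> s powr \<alpha> + 1\<close>, the decay is
  at least that of \<open>exp (- c * s)\<close>, which absorbs the cube of
  \<open>1 + s\<close>.\<close>

lemma exp_powr_integrable:
  fixes \<alpha> c :: real
  assumes "1 \<le> \<alpha>" "0 < c"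
  shows "integrable lborel (\<lambda>t. exp (- c * \<bar>t\<bar> powr \<alpha>))"
    and "integrable lborel (\<lambda>t. \<bar>t\<bar> * exp (- c * \<bar>t\<bar> powr \<alpha>))"
proof -
  define B where "B = max 1 (3 / c) ^ 3 * exp c"
  have dom: "(1 + \<bar>t\<bar>) * exp (- c * \<bar>t\<bar> powr \<alpha>) \<le> B * inverse (1 + t\<^sup>2)" for t :: real
  proof -
    define s where "s = \<bar>t\<bar>"
    have s: "0 \<le> s" "s\<^sup>2 = t\<^sup>2" by (auto simp: s_def)
    have "s \<le> s powr \<alpha> + 1"
    proof (cases "1 \<le> s")
      case True
      then show ?thesis using powr_mono[of 1 \<alpha> s] assms by simp
    qed (use powr_ge_zero[of s \<alpha>] in linarith)
    then have "c * s \<le> c * (s powr \<alpha> + 1)" using assms by (intro mult_left_mono) auto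
    then have "exp (- c * s powr \<alpha>) \<le> exp (c - c * s)" by (simp add: algebra_simps)
    \<comment> \<open>This is the cube of a linear estimate, obtained from
      \<open>1 + x \<le> exp x\<close> at \<open>x = c * s / 3\<close>.\<close>
    moreover have "(1 + s) ^ 3 \<le> max 1 (3 / c) ^ 3 * exp (c * s)"
    proof -
      have "s = 3 / c * (c * s / 3)" using assms by simp
      also have "\<dots> \<le> max 1 (3 / c) * (c * s / 3)" using assms s by (intro mult_right_mono) auto
      finally have "1 + s \<le> max 1 (3 / c) * (1 + c * s / 3)"
        unfolding distrib_left by (intro add_mono) auto
      also have "\<dots> \<le> max 1 (3 / c) * exp (c * s / 3)"
        by (intro mult_left_mono exp_ge_add_one_self) auto
      finally have "(1 + s) ^ 3 \<le> (max 1 (3 / c) * exp (c * s / 3)) ^ 3"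
        using s by (intro power_mono) auto
      also have "exp (c * s / 3) ^ 3 = exp (c * s)" by (subst exp_of_nat_mult[symmetric]) simp
      then have "(max 1 (3 / c) * exp (c * s / 3)) ^ 3 = max 1 (3 / c) ^ 3 * exp (c * s)"
        by (simp add: power_mult_distrib)
      finally show ?thesis .
    qed
    ultimately have "(1 + s) ^ 3 * exp (- c * s powr \<alpha>)
        \<le> (max 1 (3 / c) ^ 3 * exp (c * s)) * exp (c - c * s)"
      using s by (intro mult_mono) auto
    also have "\<dots> = B" by (simp add: B_def exp_diff)
    finally have "(1 + s) ^ 3 * exp (- c * s powr \<alpha>) \<le> B" .
    moreover have "(1 + s\<^sup>2) * (1 + s) \<le> (1 + s) ^ 3"
      using s by (simp add: algebra_simps power2_eq_square power3_eq_cube)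
    then have "(1 + s\<^sup>2) * (1 + s) * exp (- c * s powr \<alpha>) \<le> (1 + s) ^ 3 * exp (- c * s powr \<alpha>)"
      by (intro mult_right_mono) auto
    ultimately have "(1 + s\<^sup>2) * (1 + s) * exp (- c * s powr \<alpha>) \<le> B" by linarith
    moreover have "0 < 1 + s\<^sup>2" by (simp add: add_pos_nonneg)
    ultimately show ?thesis unfolding s(2) s_def[symmetric] by (simp add: s(2)[symmetric] field_simps)
  qed
  have "integrable lborel (\<lambda>x::real. inverse (1 + x\<^sup>2))"
    using integrable_inverse_1_plus_square by (simp add: set_integrable_def)
  then have int_dom: "integrable lborel (\<lambda>t. B * inverse (1 + t\<^sup>2))" by simp
  have dom0: "0 \<le> \<bar>t\<bar> * exp (- c * \<bar>t\<bar> powr \<alpha>)" "0 \<le> exp (- c * \<bar>t\<bar> powr \<alpha>)" for t by auto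
  have sum_eq: "(1 + \<bar>t\<bar>) * exp (- c * \<bar>t\<bar> powr \<alpha>)
      = exp (- c * \<bar>t\<bar> powr \<alpha>) + \<bar>t\<bar> * exp (- c * \<bar>t\<bar> powr \<alpha>)" for t
    by (simp add: algebra_simps)
  have "norm (exp (- c * \<bar>t\<bar> powr \<alpha>)) \<le> norm (B * inverse (1 + t\<^sup>2))" for t
    using dom[of t] dom0[of t] sum_eq[of t] by (smt (verit) real_norm_def)
  then show "integrable lborel (\<lambda>t. exp (- c * \<bar>t\<bar> powr \<alpha>))"
    by (intro Bochner_Integration.integrable_bound[OF int_dom]) auto
  have "norm (\<bar>t\<bar> * exp (- c * \<bar>t\<bar> powr \<alpha>)) \<le> norm (B * inverse (1 + t\<^sup>2))" for t
    using dom[of t] dom0[of t] sum_eq[of t] by (smt (verit) real_norm_def)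
  then show "integrable lborel (\<lambda>t. \<bar>t\<bar> * exp (- c * \<bar>t\<bar> powr \<alpha>))"
    by (intro Bochner_Integration.integrable_bound[OF int_dom]) auto
qed

text \<open>The constants are fixed before \<open>N\<close>, so that one choice serves every
  rescaled increment of the walk.\<close>

lemma stable_interval_bounds:
  fixes \<alpha> c :: real
  assumes "1 \<le> \<alpha>" "0 < c"
  obtains C \<kappa> r :: real where "0 < C" "0 < \<kappa>" "0 < r"
    and "\<And>N a b. \<lbrakk>real_distribution N; \<And>t. char N t = complex_of_real (exp (- c * \<bar>t\<bar> powr \<alpha>)); a \<le> b\<rbrakk>
      \<Longrightarrow> measure N {a<..b} \<le> C * (b - a)"
    and "\<And>N a b. \<lbrakk>real_distribution N; \<And>t. char N t = complex_of_real (exp (- c * \<bar>t\<bar> powr \<alpha>));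
        a \<le> b; -r \<le> a; b \<le> r\<rbrakk>
      \<Longrightarrow> \<kappa> * (b - a) \<le> measure N {a<..b}"
proof -
  define f where "f = (\<lambda>t::real. exp (- c * \<bar>t\<bar> powr \<alpha>))"
  define I0 where "I0 = (\<integral>t. f t \<partial>lborel)"
  define I1 where "I1 = (\<integral>t. \<bar>t\<bar> * f t \<partial>lborel)"
  have nonneg: "0 \<le> I0" "0 \<le> I1" unfolding I0_def I1_def f_def by auto
  have f_lb: "exp (- c) \<le> f t" if "\<bar>t\<bar> \<le> 1" for t
    using powr_mono2[of \<alpha> "\<bar>t\<bar>" 1] that assms by (simp add: f_def)
  have "exp (- c) / (I1 + 1) * I1 = exp (- c) * (I1 / (I1 + 1))" by simp
  also have "\<dots> \<le> exp (- c) * 1" using nonneg by (intro mult_left_mono) auto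
  finally have r: "exp (- c) / (I1 + 1) * I1 \<le> exp (- c)" by simp
  note bounds = real_distribution.cdf_increment_bounds[of _ f "exp (- c)"]
  have int: "integrable lborel f" "integrable lborel (\<lambda>t. \<bar>t\<bar> * f t)"
    using exp_powr_integrable[OF assms] by (simp_all add: f_def)
  show ?thesis
  \<comment> \<open>The first added 1 makes \<open>C\<close> positive. The second keeps the
    denominator of \<open>r\<close> positive while \<open>r * I1 \<le> exp (- c)\<close>, where
    \<open>exp (- c)\<close> is the lower bound of \<open>f\<close> on
    \<open>{-1..1}\<close>.\<close>
  proof (rule that[of "I0 / (2 * pi) + 1" "exp (- c) / (2 * pi)" "exp (- c) / (I1 + 1)"])
    fix N and a b :: real
    assume N: "real_distribution N" "\<And>t. char N t = complex_of_real (exp (- c * \<bar>t\<bar> powr \<alpha>))" and ab: "a \<le> b"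
    have "char N t = complex_of_real (f t)" "0 \<le> f t" for t
      using N(2) by (simp_all add: f_def)
    note N_bounds = bounds[OF N(1) this int f_lb ab]
    have "measure N {a<..b} \<le> (b - a) * (I0 / (2 * pi))"
      unfolding I0_def by (rule N_bounds(1))
    then show "measure N {a<..b} \<le> (I0 / (2 * pi) + 1) * (b - a)"
      using ab by (simp add: algebra_simps)
    assume ab_r: "- (exp (- c) / (I1 + 1)) \<le> a" "b \<le> exp (- c) / (I1 + 1)"
    have "(b - a) * (exp (- c) / (2 * pi)) \<le> measure N {a<..b}"
      by (rule N_bounds(2)[where r = "exp (- c) / (I1 + 1)"])
        (use ab_r r nonneg in \<open>simp_all add: I1_def[symmetric]\<close>)
    then show "exp (- c) / (2 * pi) * (b - a) \<le> measure N {a<..b}" by (simp add: mult.commute)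
  qed (use nonneg in \<open>auto intro: add_nonneg_pos divide_pos_pos\<close>)
qed

section \<open>The walk, its natural filtration and its scaling\<close>

locale stable_walk = prob_space M for M :: "'a measure" +
  fixes X :: "nat \<Rightarrow> 'a \<Rightarrow> real" and \<alpha> c :: real
  assumes \<alpha>: "1 \<le> \<alpha>" and c: "0 < c"
    and indep: "indep_vars (\<lambda>_. borel) X {1..}"
    and char_X: "1 \<le> i \<Longrightarrow> char (distr M borel (X i)) t = complex_of_real (exp (- c * \<bar>t\<bar> powr \<alpha>))"
begin

definition S :: "nat \<Rightarrow> 'a \<Rightarrow> real" where "S n \<omega> = (\<Sum>i=1..n. X i \<omega>)"

text \<open>As a pullback along the vector of the first \<open>n\<close> steps, this sigma-algebra
  presents each of its events as a preimage of a set of step vectors, the form in which independence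
  of disjoint blocks applies.\<close>

definition past :: "nat \<Rightarrow> 'a measure" where
  "past n = vimage_algebra (space M) (\<lambda>\<omega>. \<lambda>i\<in>{1..n}. X i \<omega>) (PiM {1..n} (\<lambda>_. borel))"

lemma X_measurable: "1 \<le> i \<Longrightarrow> X i \<in> borel_measurable M"
  using indep by (auto simp: indep_vars_def)

lemma S_measurable [measurable]: "S n \<in> borel_measurable M"
  unfolding S_def[abs_def] by (intro borel_measurable_sum X_measurable) auto

text \<open>Measurability of the identity says that \<open>past n\<close> is coarser than
  \<open>N\<close>. Taking \<open>N\<close> to be \<open>M\<close> or a later past yields two of the
  filtration axioms.\<close>

lemma past_measurable_id:
  assumes "space N = space M" "\<And>i. i \<in> {1..n} \<Longrightarrow> X i \<in> borel_measurable N"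
  shows "(\<lambda>\<omega>. \<omega>) \<in> measurable N (past n)"
  unfolding past_def using assms
  by (intro measurable_vimage_algebra2 measurable_restrict) auto

lemma space_past [simp]: "space (past n) = space M"
  by (simp add: past_def)

lemma X_measurable_past: "i \<in> {1..n} \<Longrightarrow> X i \<in> borel_measurable (past n)"
proof -
  assume i: "i \<in> {1..n}"
  have "(\<lambda>\<omega>. \<lambda>i\<in>{1..n}. X i \<omega>) \<in> measurable (past n) (PiM {1..n} (\<lambda>_. borel))"
    unfolding past_def by (rule measurable_vimage_algebra1) (auto simp: space_PiM)
  from measurable_compose[OF this measurable_component_singleton[OF i]] i
  show ?thesis by simp
qed

lemma S_measurable_past: "k \<le> n \<Longrightarrow> S k \<in> borel_measurable (past n)"
  unfolding S_def[abs_def] by (intro borel_measurable_sum X_measurable_past) auto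

sublocale filtered_prob_space M past
proof
  show "space (past n) = space M" for n by simp
  show "H \<in> events" if "H \<in> sets (past n)" for n H
    using measurable_sets[OF past_measurable_id[of M n] that] sets.sets_into_space[OF that]
      X_measurable by (auto simp: Int_absorb2)
  show "H \<in> sets (past n)" if "m \<le> n" "H \<in> sets (past m)" for m n H
    using measurable_sets[OF past_measurable_id[of "past n" m] that(2)] sets.sets_into_space[OF that(2)] that(1)
      X_measurable_past[of _ n] by (auto simp: Int_absorb2)
qed

text \<open>Independence produces \<open>k - j\<close> equal factors at \<open>t / \<rho>\<close>,
  and \<open>\<rho> powr \<alpha> = real (k - j)\<close> cancels their number in the
  exponent.\<close>

lemma char_increment:
  assumes "j < k"
  shows "char (distr M borel (\<lambda>\<omega>. (\<Sum>i\<in>{j<..k}. X i \<omega>) / real (k - j) powr (1 / \<alpha>))) t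
    = complex_of_real (exp (- c * \<bar>t\<bar> powr \<alpha>))"
proof -
  define \<rho> where "\<rho> = real (k - j) powr (1 / \<alpha>)"
  have \<rho>: "0 < \<rho>" "\<rho> powr \<alpha> = real (k - j)" using assms \<alpha> by (auto simp: \<rho>_def powr_powr)
  have [measurable]: "(\<lambda>\<omega>. \<Sum>i\<in>{j<..k}. X i \<omega>) \<in> borel_measurable M"
    by (intro borel_measurable_sum X_measurable) auto
  have "char (distr M borel (\<lambda>\<omega>. (\<Sum>i\<in>{j<..k}. X i \<omega>) / \<rho>)) t
      = char (distr M borel (\<lambda>\<omega>. \<Sum>i\<in>{j<..k}. X i \<omega>)) (t / \<rho>)"
    by (simp add: char_def integral_distr)
  also have "\<dots> = (\<Prod>i\<in>{j<..k}. char (distr M borel (X i)) (t / \<rho>))"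
    by (intro char_distr_sum indep_vars_subset[OF indep]) auto
  also have "\<dots> = (\<Prod>i\<in>{j<..k}. complex_of_real (exp (- c * \<bar>t / \<rho>\<bar> powr \<alpha>)))"
    by (intro prod.cong char_X) auto
  also have "\<dots> = complex_of_real (exp (- c * \<bar>t / \<rho>\<bar> powr \<alpha>) ^ (k - j))" by simp
  also have "exp (- c * \<bar>t / \<rho>\<bar> powr \<alpha>) ^ (k - j) = exp (- c * \<bar>t\<bar> powr \<alpha>)"
    using \<rho> assms by (simp add: exp_of_nat_mult[symmetric] abs_divide powr_divide)
  finally show ?thesis unfolding \<rho>_def .
qed

text \<open>Given the past of \<open>j\<close>, the target is \<open>{u<..v}\<close> shifted by
  \<open>S j\<close> and divided by the scale of the increment. The upper bound ignores the shift.
  The lower one needs the resulting endpoints in \<open>{-r..r}\<close>, whence the bound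
  \<open>R\<close> on the position and the two conditions on \<open>R\<close>.\<close>

lemma increment_bounds:
  obtains C \<kappa> r :: real where "0 < C" "0 < \<kappa>" "0 < r"
    and "\<And>j k u v H. \<lbrakk>j < k; u \<le> v; H \<in> sets (past j)\<rbrakk>
      \<Longrightarrow> prob (H \<inter> {\<omega> \<in> space M. S k \<omega> \<in> {u<..v}}) \<le> prob H * (C * ((v - u) / real (k - j) powr (1 / \<alpha>)))"
    and "\<And>j k u v H R. \<lbrakk>j < k; u \<le> v; H \<in> sets (past j); H \<subseteq> {\<omega>. \<bar>S j \<omega>\<bar> \<le> R};
        R + \<bar>u\<bar> \<le> r * real (k - j) powr (1 / \<alpha>); R + \<bar>v\<bar> \<le> r * real (k - j) powr (1 / \<alpha>)\<rbrakk>
      \<Longrightarrow> prob H * (\<kappa> * ((v - u) / real (k - j) powr (1 / \<alpha>))) \<le> prob (H \<inter> {\<omega> \<in> space M. S k \<omega> \<in> {u<..v}})"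
proof -
  from stable_interval_bounds[OF \<alpha> c] obtain C \<kappa> r :: real where pos: "0 < C" "0 < \<kappa>" "0 < r"
    and upper: "\<And>N a b. \<lbrakk>real_distribution N; \<And>t. char N t = complex_of_real (exp (- c * \<bar>t\<bar> powr \<alpha>)); a \<le> b\<rbrakk>
      \<Longrightarrow> measure N {a<..b} \<le> C * (b - a)"
    and lower: "\<And>N a b. \<lbrakk>real_distribution N; \<And>t. char N t = complex_of_real (exp (- c * \<bar>t\<bar> powr \<alpha>));
        a \<le> b; -r \<le> a; b \<le> r\<rbrakk> \<Longrightarrow> \<kappa> * (b - a) \<le> measure N {a<..b}"
    by blast
  have both: "prob (H \<inter> {\<omega> \<in> space M. S k \<omega> \<in> {u<..v}}) \<le> prob H * (C * ((v - u) / real (k - j) powr (1 / \<alpha>)))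
      \<and> (H \<subseteq> {\<omega>. \<bar>S j \<omega>\<bar> \<le> R} \<and> R + \<bar>u\<bar> \<le> r * real (k - j) powr (1 / \<alpha>) \<and> R + \<bar>v\<bar> \<le> r * real (k - j) powr (1 / \<alpha>) \<longrightarrow>
        prob H * (\<kappa> * ((v - u) / real (k - j) powr (1 / \<alpha>))) \<le> prob (H \<inter> {\<omega> \<in> space M. S k \<omega> \<in> {u<..v}}))"
    if jk: "j < k" and uv: "u \<le> v" and H: "H \<in> sets (past j)" for j k u v H R
  proof -
    define \<rho> where "\<rho> = real (k - j) powr (1 / \<alpha>)"
    have \<rho>: "0 < \<rho>" using jk by (simp add: \<rho>_def)
    define U where "U = (\<lambda>\<omega>. \<lambda>i\<in>{1..j}. X i \<omega>)"
    define D where "D = (\<lambda>\<omega>. \<lambda>i\<in>{j<..k}. X i \<omega>)"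
    define g where "g = (\<lambda>x::nat \<Rightarrow> real. \<Sum>i=1..j. x i)"
    define h where "h = (\<lambda>x::nat \<Rightarrow> real. \<Sum>i\<in>{j<..k}. x i)"
    have ind: "indep_var (PiM {1..j} (\<lambda>_. borel)) U (PiM {j<..k} (\<lambda>_. borel)) D"
      unfolding U_def D_def by (rule indep_var_restrict[OF indep]) auto
    have D_meas [measurable]: "D \<in> measurable M (PiM {j<..k} (\<lambda>_. borel))"
      using ind unfolding indep_var_distribution_eq by auto
    have g [measurable]: "g \<in> borel_measurable (PiM {1..j} (\<lambda>_. borel))"
      and h [measurable]: "h \<in> borel_measurable (PiM {j<..k} (\<lambda>_. borel))"
      unfolding g_def h_def by measurable
    have hD: "h (D \<omega>) = (\<Sum>i\<in>{j<..k}. X i \<omega>)" and gU: "g (U \<omega>) = S j \<omega>" for \<omega>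
      by (auto simp: h_def D_def g_def U_def S_def intro!: sum.cong)
    have "{1..k} = {1..j} \<union> {j<..k}" using jk by auto
    then have Sk: "S k \<omega> = g (U \<omega>) + h (D \<omega>)" for \<omega>
      unfolding hD gU S_def by (simp add: sum.union_disjoint[symmetric] disjoint_iff)
    obtain B' where B': "B' \<in> sets (PiM {1..j} (\<lambda>_. borel))" "H = U -` B' \<inter> space M"
      using H unfolding past_def U_def[symmetric]
      by (subst (asm) sets_vimage_algebra2) (auto simp: U_def space_PiM)
    have distr: "real_distribution (distr M borel (\<lambda>\<omega>. h (D \<omega>) / \<rho>))"
      by (rule real_distribution_distr) measurable
    have char: "char (distr M borel (\<lambda>\<omega>. h (D \<omega>) / \<rho>)) t = complex_of_real (exp (- c * \<bar>t\<bar> powr \<alpha>))" for t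
      unfolding hD \<rho>_def by (rule char_increment[OF jk])
    have scale: "prob {\<omega> \<in> space M. s + h (D \<omega>) \<in> {u<..v}}
        = measure (distr M borel (\<lambda>\<omega>. h (D \<omega>) / \<rho>)) {(u - s) / \<rho><..(v - s) / \<rho>}" for s
      using \<rho> by (subst measure_distr)
        (auto simp: divide_less_cancel divide_le_cancel algebra_simps intro!: arg_cong[where f = prob])
    have width: "(v - s) / \<rho> - (u - s) / \<rho> = (v - u) / \<rho>" for s by (simp add: diff_divide_distrib)
    have ordered: "(u - s) / \<rho> \<le> (v - s) / \<rho>" for s using uv \<rho> by (simp add: divide_right_mono)
    \<comment> \<open>The disjunction lets one \<open>B\<close> serve both estimates: it represents
      \<open>H\<close> in every case, and forces \<open>g x\<close> to be bounded by
      \<open>R\<close> as soon as \<open>S j\<close> is so bounded on \<open>H\<close>.\<close>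
    define B where "B = {x \<in> space (PiM {1..j} (\<lambda>_. borel)). x \<in> B' \<and> (\<bar>g x\<bar> \<le> R \<or> \<not> (H \<subseteq> {\<omega>. \<bar>S j \<omega>\<bar> \<le> R}))}"
    have B: "B \<in> sets (PiM {1..j} (\<lambda>_. borel))" unfolding B_def using B' by measurable
    have HB: "H = {\<omega> \<in> space M. U \<omega> \<in> B}"
    proof -
      have "U \<omega> \<in> space (PiM {1..j} (\<lambda>_. borel))" for \<omega> by (auto simp: U_def space_PiM)
      then show ?thesis using B'(2) by (auto simp: B_def gU)
    qed
    then have HS: "H \<inter> {\<omega> \<in> space M. S k \<omega> \<in> {u<..v}} = {\<omega> \<in> space M. U \<omega> \<in> B \<and> g (U \<omega>) + h (D \<omega>) \<in> {u<..v}}"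
      unfolding Sk by auto
    have w: "0 \<le> (v - u) / \<rho>" using uv \<rho> by simp
    have "prob (H \<inter> {\<omega> \<in> space M. S k \<omega> \<in> {u<..v}}) \<le> prob H * (C * ((v - u) / \<rho>))"
      unfolding HS unfolding HB
    proof (rule indep_var_sum_bounds(1)[OF ind B g h])
      show "prob {\<omega> \<in> space M. g x + h (D \<omega>) \<in> {u<..v}} \<le> C * ((v - u) / \<rho>)" for x
        using upper[OF distr char ordered, of "g x"] unfolding scale width .
    qed (use w pos in \<open>auto simp del: times_divide_eq_right\<close>)
    moreover have "prob H * (\<kappa> * ((v - u) / \<rho>)) \<le> prob (H \<inter> {\<omega> \<in> space M. S k \<omega> \<in> {u<..v}})"
      if S_bd: "H \<subseteq> {\<omega>. \<bar>S j \<omega>\<bar> \<le> R}" and R: "R + \<bar>u\<bar> \<le> r * \<rho>" "R + \<bar>v\<bar> \<le> r * \<rho>"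
      unfolding HS unfolding HB
    proof (rule indep_var_sum_bounds(2)[OF ind B g h])
      show "\<kappa> * ((v - u) / \<rho>) \<le> prob {\<omega> \<in> space M. g x + h (D \<omega>) \<in> {u<..v}}" if "x \<in> B" for x
      proof -
        have gx: "\<bar>g x\<bar> \<le> R" using that S_bd by (auto simp: B_def)
        have "- r \<le> (u - g x) / \<rho>" "(v - g x) / \<rho> \<le> r" using \<rho> gx R by (auto simp: field_simps)
        then show ?thesis using lower[OF distr char ordered, of "g x"] unfolding scale width by simp
      qed
    qed (use w pos in \<open>auto simp del: times_divide_eq_right\<close>)
    ultimately show ?thesis unfolding \<rho>_def by blast
  qed
  show ?thesis by (rule that[OF pos]) (use both in blast)+
qed

end

subsection \<open>Accumulation points in the extended reals\<close>

lemma infinite_ge_1: "infinite {n::nat. P n} \<Longrightarrow> infinite {n. 1 \<le> n \<and> P n}"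
proof
  assume inf: "infinite {n. P n}" and "finite {n. 1 \<le> n \<and> P n}"
  then have "finite (insert 0 {n. 1 \<le> n \<and> P n})" by simp
  moreover have "{n. P n} \<subseteq> insert 0 {n. 1 \<le> n \<and> P n}" by auto
  ultimately show False using inf finite_subset by blast
qed

text \<open>Neighbourhoods of the infinities contain real points, so recurrence near real targets
  suffices. Rational centres and radii \<open>1 / real (Suc m)\<close> leave countably many
  conditions, which can hold almost surely all at once.\<close>

lemma accum_pts_eq_UNIV:
  assumes "\<And>q m. q \<in> \<rat> \<Longrightarrow> infinite {n. x n \<in> {q - 1 / real (Suc m)<..q + 1 / real (Suc m)}}"
  shows "accum_pts x = UNIV"
proof -
  have "infinite {n. 1 \<le> n \<and> ereal (x n) \<in> U}" if U: "open U" "a \<in> U" for U a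
  proof -
    define V where "V = ereal -` U"
    have V: "open V" unfolding V_def using U(1) by (intro open_vimage continuous_on_ereal continuous_on_id)
    have "V \<noteq> {}"
    proof (cases a)
      case (real z)
      then show ?thesis using U by (auto simp: V_def)
    next
      case PInf
      then obtain z where "{ereal z<..} \<subseteq> U" using U open_PInfty[of U] by auto
      then have "z + 1 \<in> V" by (auto simp: V_def)
      then show ?thesis by auto
    next
      case MInf
      then obtain z where "{..<ereal z} \<subseteq> U" using U open_MInfty[of U] by auto
      then have "z - 1 \<in> V" by (auto simp: V_def)
      then show ?thesis by auto
    qed
    then obtain z where "z \<in> V" by blast
    with V obtain e where e: "0 < e" "\<And>y. \<bar>y - z\<bar> < e \<Longrightarrow> y \<in> V"
      by (auto simp: open_dist dist_real_def)
    \<comment> \<open>A centre within \<open>e / 2\<close> of \<open>z\<close> and a radius below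
      \<open>e / 2\<close> keep the interval within distance \<open>e\<close> of
      \<open>z\<close>.\<close>
    obtain q where q: "q \<in> \<rat>" "z < q" "q < z + e / 2" using Rats_dense_in_real[of z "z + e / 2"] e by auto
    obtain m where m: "1 / real (Suc m) < e / 2" using nat_approx_posE[of "e / 2"] e by auto
    have "{n. 1 \<le> n \<and> x n \<in> {q - 1 / real (Suc m)<..q + 1 / real (Suc m)}} \<subseteq> {n. 1 \<le> n \<and> ereal (x n) \<in> U}"
    proof safe
      fix n assume "x n \<in> {q - 1 / real (Suc m)<..q + 1 / real (Suc m)}"
      then have "x n \<in> V" using q m by (intro e(2)) (auto simp: abs_less_iff)
      then show "ereal (x n) \<in> U" by (simp add: V_def)
    qed
    then show ?thesis using infinite_ge_1[OF assms[OF q(1), of m]] finite_subset by blast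
  qed
  then show ?thesis by (auto simp: accum_pts_def)
qed

text \<open>Escape of the absolute values excludes finite accumulation points and pushes the
  infinitely many terms of each sign towards the corresponding infinity.\<close>

lemma accum_pts_eq_infinities:
  assumes large: "\<And>K::nat. eventually (\<lambda>n. real K < \<bar>x n\<bar>) sequentially"
    and pos: "infinite {n. 0 < x n}" and neg: "infinite {n. x n \<le> 0}"
  shows "accum_pts x = {-\<infinity>, \<infinity>}"
proof -
  have large_real: "eventually (\<lambda>n. z < \<bar>x n\<bar>) sequentially" for z
  proof -
    obtain K where "z < real K" using reals_Archimedean2 by blast
    with large[of K] show ?thesis by (auto elim: eventually_mono)
  qed
  have inf_many: "infinite {n. 1 \<le> n \<and> P n \<and> z < \<bar>x n\<bar>}" if "infinite {n. P n}" for P z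
  proof -
    obtain N where "\<And>n. N \<le> n \<Longrightarrow> z < \<bar>x n\<bar>" using large_real[of z] by (auto simp: eventually_sequentially)
    then have "{n. 1 \<le> n \<and> P n} \<subseteq> {..<N} \<union> {n. 1 \<le> n \<and> P n \<and> z < \<bar>x n\<bar>}" by (force simp: not_le)
    then show ?thesis using infinite_ge_1[OF that] by (meson finite_UnI finite_lessThan finite_subset)
  qed
  have "\<infinity> \<in> accum_pts x" unfolding accum_pts_def
  proof (intro CollectI allI impI)
    fix U :: "ereal set" assume "open U \<and> \<infinity> \<in> U"
    then obtain z where z: "{ereal z<..} \<subseteq> U" using open_PInfty[of U] by auto
    have "{n. 1 \<le> n \<and> 0 < x n \<and> z < \<bar>x n\<bar>} \<subseteq> {n. 1 \<le> n \<and> ereal (x n) \<in> U}"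
      using z by auto
    then show "infinite {n. 1 \<le> n \<and> ereal (x n) \<in> U}" using inf_many[OF pos] finite_subset by blast
  qed
  moreover have "-\<infinity> \<in> accum_pts x" unfolding accum_pts_def
  proof (intro CollectI allI impI)
    fix U :: "ereal set" assume "open U \<and> -\<infinity> \<in> U"
    then obtain z where z: "{..<ereal z} \<subseteq> U" using open_MInfty[of U] by auto
    have "{n. 1 \<le> n \<and> x n \<le> 0 \<and> - z < \<bar>x n\<bar>} \<subseteq> {n. 1 \<le> n \<and> ereal (x n) \<in> U}"
      using z by auto
    then show "infinite {n. 1 \<le> n \<and> ereal (x n) \<in> U}" using inf_many[OF neg] finite_subset by blast
  qed
  moreover have "ereal z \<notin> accum_pts x" for z
  proof
    assume "ereal z \<in> accum_pts x"
    moreover have "open {ereal (z - 1)<..<ereal (z + 1)} \<and> ereal z \<in> {ereal (z - 1)<..<ereal (z + 1)}" by simp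
    ultimately have "infinite {n. 1 \<le> n \<and> ereal (x n) \<in> {ereal (z - 1)<..<ereal (z + 1)}}"
      unfolding accum_pts_def by blast
    moreover obtain N where N: "\<And>n. N \<le> n \<Longrightarrow> \<bar>z\<bar> + 1 < \<bar>x n\<bar>"
      using large_real[of "\<bar>z\<bar> + 1"] by (auto simp: eventually_sequentially)
    have "{n. 1 \<le> n \<and> ereal (x n) \<in> {ereal (z - 1)<..<ereal (z + 1)}} \<subseteq> {..<N}"
    proof
      fix n assume "n \<in> {n. 1 \<le> n \<and> ereal (x n) \<in> {ereal (z - 1)<..<ereal (z + 1)}}"
      then have "\<not> \<bar>z\<bar> + 1 < \<bar>x n\<bar>" by auto
      then show "n \<in> {..<N}" using N[of n] by force
    qed
    ultimately show False using finite_subset by blast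
  qed
  ultimately show ?thesis
    by (intro equalityI subsetI) (metis ereal_cases insert_iff, blast)
qed

lemma sum_powr_at_top:
  assumes "\<gamma> \<le> 1"
  shows "filterlim (\<lambda>d. \<Sum>i=1..d. real i powr - \<gamma>) at_top sequentially"
proof -
  let ?T = "\<lambda>d. \<Sum>i=1..d. real i powr - \<gamma>"
  have not_summable: "\<not> summable (\<lambda>i. real i powr - \<gamma>)"
    using assms summable_real_powr_iff[of "- \<gamma>"] by simp
  show ?thesis unfolding filterlim_at_top
  proof
    fix Z
    have "\<exists>d. Z < ?T d"
    proof (rule ccontr)
      assume "\<not> (\<exists>d. Z < ?T d)"
      then have bd: "?T d \<le> Z" for d by (simp add: not_less)
      \<comment> \<open>Index 0 contributes nothing, because
        \<open>0 powr - \<gamma> = 0\<close>.\<close>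
      have "{..d} = insert 0 {1..d}" for d :: nat by auto
      then have "(\<Sum>i\<le>d. real i powr - \<gamma>) \<le> Z" for d using bd[of d] by simp
      then show False using not_summable bounded_imp_summable[of "\<lambda>i. real i powr - \<gamma>" Z] by simp
    qed
    then obtain d where d: "Z < ?T d" by blast
    have "?T d \<le> ?T d'" if "d \<le> d'" for d' using that by (intro sum_mono2) auto
    then show "eventually (\<lambda>d. Z \<le> ?T d) sequentially"
      using d unfolding eventually_sequentially by (intro exI[of _ d]) force
  qed
qed

subsection \<open>Visits and oscillation of the walk\<close>

context stable_walk
begin

lemma eventually_time_large:
  assumes "0 < r"
  shows "eventually (\<lambda>k. K \<le> r * real (k - n) powr (1 / \<alpha>)) sequentially"
proof -
  have "filterlim (\<lambda>k. r * real k powr (1 / \<alpha>)) at_top sequentially"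
    using assms \<alpha> by real_asymp
  then have "filterlim (\<lambda>k. r * real (k - n) powr (1 / \<alpha>)) at_top sequentially"
    by (rule filterlim_compose) (rule filterlim_minus_const_nat_at_top)
  then show ?thesis by (simp add: filterlim_at_top)
qed

lemma prob_increment_le:
  obtains C :: real where "0 < C"
    and "\<And>j k u v H. \<lbrakk>j < k; u \<le> v; H \<in> sets (past j)\<rbrakk>
      \<Longrightarrow> prob (H \<inter> {\<omega> \<in> space M. S k \<omega> \<in> {u<..v}}) \<le> prob H * (C * ((v - u) / real (k - j) powr (1 / \<alpha>)))"
proof (rule increment_bounds, goal_cases)
  case (1 C \<kappa> r)
  show ?case by (rule 1(1)[OF 1(2)], rule 1(5))
qed

lemma prob_increment_ge:
  obtains \<kappa> r :: real where "0 < \<kappa>" "0 < r"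
    and "\<And>j k u v H R. \<lbrakk>j < k; u \<le> v; H \<in> sets (past j); H \<subseteq> {\<omega>. \<bar>S j \<omega>\<bar> \<le> R};
        R + \<bar>u\<bar> \<le> r * real (k - j) powr (1 / \<alpha>); R + \<bar>v\<bar> \<le> r * real (k - j) powr (1 / \<alpha>)\<rbrakk>
      \<Longrightarrow> prob H * (\<kappa> * ((v - u) / real (k - j) powr (1 / \<alpha>))) \<le> prob (H \<inter> {\<omega> \<in> space M. S k \<omega> \<in> {u<..v}})"
proof (rule increment_bounds, goal_cases)
  case (1 C \<kappa> r)
  show ?case by (rule 1(1)[OF 1(3,4)], rule 1(6))
qed

text \<open>The lower increment bound requires a bounded starting position. \<open>R\<close> depends
  on \<open>G\<close>, but the retained fraction does not, so hitting constants stay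
  uniform.\<close>

lemma past_bounded_part:
  assumes G: "G \<in> sets (past n)"
  obtains H R where "H \<in> sets (past n)" "H \<subseteq> G" "H \<subseteq> {\<omega>. \<bar>S n \<omega>\<bar> \<le> R}" "prob G / 2 \<le> prob H"
proof -
  have [measurable]: "G \<in> events" using G F_events by blast
  obtain R where R: "prob G / 2 \<le> prob (G \<inter> {\<omega> \<in> space M. \<bar>S n \<omega>\<bar> \<le> R})"
    using half_mass_bounded[of "S n" G] by auto
  have [measurable]: "S n \<in> borel_measurable (past n)" by (rule S_measurable_past) simp
  have "{\<omega> \<in> space (past n). \<bar>S n \<omega>\<bar> \<le> R} \<in> sets (past n)" by measurable
  then show ?thesis using G R by (intro that[of "G \<inter> {\<omega> \<in> space M. \<bar>S n \<omega>\<bar> \<le> R}" R]) auto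
qed

text \<open>On \<open>G\<close>, the expected number of visits grows at least like
  \<open>prob H * (\<kappa> * (2 * \<delta>)) * T d\<close>, and is at most the hitting probability
  times \<open>1 + C * (2 * \<delta>) * T d\<close>. As \<open>T\<close> diverges, the quotient
  leaves \<open>\<kappa> / C * prob H\<close>, and \<open>H\<close> carries half of
  \<open>G\<close>.\<close>

lemma AE_hits_target:
  assumes \<epsilon>: "0 \<le> \<epsilon>" "\<epsilon> \<le> 1 - 1 / \<alpha>" and \<delta>: "0 < \<delta>"
  shows "AE \<omega> in M. infinite {n. real n powr \<epsilon> * S n \<omega> \<in> {a - \<delta><..a + \<delta>}}"
proof -
  obtain C :: real where C: "0 < C"
    and upper: "\<And>j k u v H. \<lbrakk>j < k; u \<le> v; H \<in> sets (past j)\<rbrakk>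
      \<Longrightarrow> prob (H \<inter> {\<omega> \<in> space M. S k \<omega> \<in> {u<..v}}) \<le> prob H * (C * ((v - u) / real (k - j) powr (1 / \<alpha>)))"
    by (rule prob_increment_le) blast
  obtain \<kappa> r :: real where \<kappa>: "0 < \<kappa>" "0 < r"
    and lower: "\<And>j k u v H R. \<lbrakk>j < k; u \<le> v; H \<in> sets (past j); H \<subseteq> {\<omega>. \<bar>S j \<omega>\<bar> \<le> R};
        R + \<bar>u\<bar> \<le> r * real (k - j) powr (1 / \<alpha>); R + \<bar>v\<bar> \<le> r * real (k - j) powr (1 / \<alpha>)\<rbrakk>
      \<Longrightarrow> prob H * (\<kappa> * ((v - u) / real (k - j) powr (1 / \<alpha>))) \<le> prob (H \<inter> {\<omega> \<in> space M. S k \<omega> \<in> {u<..v}})"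
    by (rule prob_increment_ge) blast
  note pos = C \<kappa>
  define \<gamma> where "\<gamma> = \<epsilon> + 1 / \<alpha>"
  have \<gamma>: "\<gamma> \<le> 1" using \<epsilon> by (simp add: \<gamma>_def)
  define T where "T = (\<lambda>d. \<Sum>i=1..d. real i powr - \<gamma>)"
  have T_lim: "filterlim T at_top sequentially" unfolding T_def by (rule sum_powr_at_top[OF \<gamma>])
  define A where "A = (\<lambda>n. {\<omega> \<in> space M. real n powr \<epsilon> * S n \<omega> \<in> {a - \<delta><..a + \<delta>}})"
  have A_past: "A n \<in> sets (past n)" for n
  proof -
    have "(\<lambda>\<omega>. real n powr \<epsilon> * S n \<omega>) \<in> borel_measurable (past n)"
      by (intro borel_measurable_times borel_measurable_const S_measurable_past order_refl)
    moreover have "A n = (\<lambda>\<omega>. real n powr \<epsilon> * S n \<omega>) -` {a - \<delta><..a + \<delta>} \<inter> space (past n)"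
      unfolding A_def space_past by blast
    ultimately show ?thesis by (simp only: measurable_sets sets.sets_into_space greaterThanAtMost_borel)
  qed
  have A_events [measurable]: "A n \<in> events" for n using A_past F_events by blast
  define lo where "lo = (\<lambda>k::nat. (a - \<delta>) / real k powr \<epsilon>)"
  define hi where "hi = (\<lambda>k::nat. (a + \<delta>) / real k powr \<epsilon>)"
  have A_eq: "A k = {\<omega> \<in> space M. S k \<omega> \<in> {lo k<..hi k}}" if "0 < k" for k
    using that by (auto simp: A_def lo_def hi_def field_simps)
  have lo_hi: "hi k - lo k = 2 * \<delta> / real k powr \<epsilon>" "lo k \<le> hi k" for k
    using \<delta> by (auto simp: lo_def hi_def diff_divide_distrib[symmetric] divide_right_mono)
  define b where "b = (\<lambda>i. C * (2 * \<delta>) * real i powr - \<gamma>)"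
  \<comment> \<open>Since \<open>0 \<le> \<epsilon>\<close> and \<open>k - j \<le> k\<close>, the
    target at time \<open>k\<close> is no wider than
    \<open>2 * \<delta> / real (k - j) powr \<epsilon>\<close>; the bound then depends on the gap
    only, as \<open>sum_hits_le\<close> requires.\<close>
  have step: "prob (H \<inter> A k) \<le> prob H * b (k - j)" if "j < k" "H \<in> sets (past j)" for j k H
  proof -
    have "prob (H \<inter> A k) \<le> prob H * (C * ((hi k - lo k) / real (k - j) powr (1 / \<alpha>)))"
      using upper[OF that(1) lo_hi(2) that(2)] A_eq[of k] that by simp
    also have "(hi k - lo k) / real (k - j) powr (1 / \<alpha>)
        \<le> (2 * \<delta> / real (k - j) powr \<epsilon>) / real (k - j) powr (1 / \<alpha>)"
      unfolding lo_hi(1) using \<delta> \<epsilon> that by (intro divide_right_mono divide_left_mono powr_mono2) auto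
    also have "\<dots> = 2 * \<delta> * real (k - j) powr - \<gamma>"
      using that unfolding \<gamma>_def powr_minus powr_add by (simp add: field_simps)
    finally show ?thesis using pos by (simp add: b_def mult_left_mono mult.assoc)
  qed
  have hit: "\<kappa> / (2 * C) * prob G \<le> prob (G \<inter> (\<Union>k\<in>{n<..}. A k))" if G: "G \<in> sets (past n)" for n G
  proof -
    have [measurable]: "G \<in> events" using G F_events by blast
    obtain H R where H_past: "H \<in> sets (past n)" and H: "H \<subseteq> G" "H \<subseteq> {\<omega>. \<bar>S n \<omega>\<bar> \<le> R}"
      and half: "prob G / 2 \<le> prob H"
      by (rule past_bounded_part[OF G])
    have [measurable]: "H \<in> events" using H_past F_events by blast
    have "eventually (\<lambda>k. R + (\<bar>a\<bar> + \<delta>) \<le> r * real (k - n) powr (1 / \<alpha>)) sequentially"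
      by (rule eventually_time_large[OF pos(3)])
    then obtain k1 where k1: "\<And>k. k1 \<le> k \<Longrightarrow> R + (\<bar>a\<bar> + \<delta>) \<le> r * real (k - n) powr (1 / \<alpha>)"
      by (auto simp: eventually_sequentially)
    \<comment> \<open>Beyond \<open>k1\<close> the scale of the increment accommodates
      \<open>R\<close> together with the target, whose endpoints are only shrunk by division by
      \<open>real k powr \<epsilon>\<close>; beyond \<open>n\<close> the gap is positive.\<close>
    define k0 where "k0 = max k1 n"
    have low: "prob H * (\<kappa> * (2 * \<delta>)) * real k powr - \<gamma> \<le> prob (G \<inter> A k)" if k: "k0 < k" for k
    proof -
      have k': "n < k" "k1 \<le> k" "1 \<le> k" using k by (auto simp: k0_def)
      have "1 \<le> real k powr \<epsilon>" using k' \<epsilon> by (simp add: ge_one_powr_ge_zero)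
      then have div_le: "\<bar>y / real k powr \<epsilon>\<bar> \<le> \<bar>y\<bar>" for y
        by (simp add: divide_le_eq mult_le_cancel_left1)
      have "R + \<bar>lo k\<bar> \<le> r * real (k - n) powr (1 / \<alpha>)" "R + \<bar>hi k\<bar> \<le> r * real (k - n) powr (1 / \<alpha>)"
        using k1[OF k'(2)] div_le[of "a - \<delta>"] div_le[of "a + \<delta>"] \<delta> by (auto simp: lo_def hi_def)
      then have "prob H * (\<kappa> * ((hi k - lo k) / real (k - n) powr (1 / \<alpha>))) \<le> prob (H \<inter> A k)"
        unfolding A_eq[OF less_le_trans[OF zero_less_one k'(3)]]
        by (intro lower[OF k'(1) lo_hi(2) H_past H(2)])
      also have "\<dots> \<le> prob (G \<inter> A k)" using H(1) by (intro finite_measure_mono) auto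
      finally have "prob H * (\<kappa> * ((hi k - lo k) / real (k - n) powr (1 / \<alpha>))) \<le> prob (G \<inter> A k)" .
      moreover have "2 * \<delta> * real k powr - \<gamma> = (hi k - lo k) / real k powr (1 / \<alpha>)"
        unfolding lo_hi(1) \<gamma>_def powr_minus powr_add using k' by (simp add: field_simps)
      \<comment> \<open>Replacing the gap by \<open>k\<close> weakens the lower bound but produces
        the very terms of \<open>T\<close>.\<close>
      moreover have "(hi k - lo k) / real k powr (1 / \<alpha>) \<le> (hi k - lo k) / real (k - n) powr (1 / \<alpha>)"
        using k' \<alpha> lo_hi(2)[of k] by (intro divide_left_mono powr_mono2) auto
      ultimately have "prob H * (\<kappa> * (2 * \<delta> * real k powr - \<gamma>)) \<le> prob (G \<inter> A k)"
        using pos by (smt (verit) measure_nonneg mult_left_mono)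
      then show ?thesis by (simp add: mult_ac)
    qed
    define p where "p = prob (G \<inter> (\<Union>k\<in>{n<..}. A k))"
    have prob_ge: "prob H * (\<kappa> * (2 * \<delta>)) * ((T d - T k0) / (1 + C * (2 * \<delta>) * T d)) \<le> p" if d: "k0 \<le> d" for d
    proof -
      have T_nonneg: "0 \<le> T d" unfolding T_def by (intro sum_nonneg) auto
      have "{1..d} = {1..k0} \<union> {k0<..d}" using d by auto
      then have "T d - T k0 = (\<Sum>k\<in>{k0<..d}. real k powr - \<gamma>)"
        unfolding T_def by (simp add: sum.union_disjoint disjoint_iff)
      then have "prob H * (\<kappa> * (2 * \<delta>)) * (T d - T k0)
          = (\<Sum>k\<in>{k0<..d}. prob H * (\<kappa> * (2 * \<delta>)) * real k powr - \<gamma>)" by (simp add: sum_distrib_left)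
      also have "\<dots> \<le> (\<Sum>k\<in>{k0<..d}. prob (G \<inter> A k))" by (intro sum_mono low) auto
      \<comment> \<open>As \<open>n \<le> k0\<close>, the times in \<open>{k0<..d}\<close> all lie
        in \<open>{n<..n+d}\<close>.\<close>
      also have "\<dots> \<le> (\<Sum>k\<in>{n<..n+d}. prob (G \<inter> A k))" by (intro sum_mono2) (auto simp: k0_def)
      also have "\<dots> \<le> prob (G \<inter> (\<Union>k\<in>{n<..n+d}. A k)) * (1 + (\<Sum>i=1..d. b i))"
        by (rule sum_hits_le[OF A_past _ step G]) (use pos \<delta> in \<open>auto simp: b_def\<close>)
      also have "(\<Sum>i=1..d. b i) = C * (2 * \<delta>) * T d" by (simp add: b_def T_def sum_distrib_left)
      also have "prob (G \<inter> (\<Union>k\<in>{n<..n+d}. A k)) * (1 + C * (2 * \<delta>) * T d)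
          \<le> p * (1 + C * (2 * \<delta>) * T d)"
        unfolding p_def using T_nonneg pos \<delta> by (intro mult_right_mono finite_measure_mono) auto
      finally have "prob H * (\<kappa> * (2 * \<delta>)) * (T d - T k0) \<le> p * (1 + C * (2 * \<delta>) * T d)" .
      moreover have "0 < 1 + C * (2 * \<delta>) * T d" using T_nonneg pos \<delta> by (intro add_pos_nonneg) auto
      ultimately show ?thesis by (simp add: pos_divide_le_eq)
    qed
    \<comment> \<open>The offsets \<open>T k0\<close> and 1 vanish in the limit, and with them the
      dependence on \<open>n\<close> and \<open>G\<close>.\<close>
    have "((\<lambda>x. (x - T k0) / (1 + C * (2 * \<delta>) * x)) \<longlongrightarrow> inverse C * inverse \<delta> / 2) at_top"
      using pos \<delta> by real_asymp
    moreover have "inverse C * inverse \<delta> / 2 = 1 / (C * (2 * \<delta>))" by (simp add: divide_simps)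
    ultimately have T_ratio: "((\<lambda>x. (x - T k0) / (1 + C * (2 * \<delta>) * x)) \<longlongrightarrow> 1 / (C * (2 * \<delta>))) at_top"
      by simp
    have "(\<lambda>d. prob H * (\<kappa> * (2 * \<delta>)) * ((T d - T k0) / (1 + C * (2 * \<delta>) * T d)))
        \<longlonglongrightarrow> prob H * (\<kappa> * (2 * \<delta>)) * (1 / (C * (2 * \<delta>)))"
      by (intro tendsto_mult_left filterlim_compose[OF T_ratio T_lim])
    then have "prob H * (\<kappa> * (2 * \<delta>)) * (1 / (C * (2 * \<delta>))) \<le> p"
      by (rule LIMSEQ_le_const2) (intro exI[of _ k0] allI impI prob_ge)
    then have "\<kappa> / C * prob H \<le> p" using pos \<delta> by (simp add: field_simps)
    moreover have "\<kappa> / C * (prob G / 2) \<le> \<kappa> / C * prob H"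
      using half pos by (intro mult_left_mono) auto
    ultimately show ?thesis by (simp add: p_def)
  qed
  have "AE \<omega> in M. infinite {n. \<omega> \<in> A n}"
    by (rule AE_infinitely_often[OF A_past _ hit]) (use pos in auto)
  then show ?thesis
    by (rule AE_mp, intro AE_I2 impI) (simp add: A_def)
qed

text \<open>A single late time suffices. At scale \<open>\<rho>\<close>, an interval of width
  \<open>r / 2 * \<rho>\<close> adjacent to 0 leaves room \<open>r / 2 * \<rho>\<close> for the
  starting position, and \<open>\<rho>\<close> cancels from its hitting probability.\<close>

lemma AE_both_signs:
  "AE \<omega> in M. infinite {n. 0 < S n \<omega>}"
  "AE \<omega> in M. infinite {n. S n \<omega> \<le> 0}"
proof -
  obtain \<kappa> r :: real where pos: "0 < \<kappa>" "0 < r"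
    and lower: "\<And>j k u v H R. \<lbrakk>j < k; u \<le> v; H \<in> sets (past j); H \<subseteq> {\<omega>. \<bar>S j \<omega>\<bar> \<le> R};
        R + \<bar>u\<bar> \<le> r * real (k - j) powr (1 / \<alpha>); R + \<bar>v\<bar> \<le> r * real (k - j) powr (1 / \<alpha>)\<rbrakk>
      \<Longrightarrow> prob H * (\<kappa> * ((v - u) / real (k - j) powr (1 / \<alpha>))) \<le> prob (H \<inter> {\<omega> \<in> space M. S k \<omega> \<in> {u<..v}})"
    by (rule prob_increment_ge) blast
  have sign: "AE \<omega> in M. infinite {n. S n \<omega> \<in> J}"
    if J: "J \<in> sets borel" and wide: "\<And>w. 0 < w \<Longrightarrow> \<exists>u v. {u<..v} \<subseteq> J \<and> v - u = w \<and> \<bar>u\<bar> \<le> w \<and> \<bar>v\<bar> \<le> w" for J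
  proof -
    define A where "A = (\<lambda>n. {\<omega> \<in> space M. S n \<omega> \<in> J})"
    have A_past: "A n \<in> sets (past n)" for n
      using measurable_sets[OF S_measurable_past[of n n] J]
      by (simp add: A_def vimage_def Int_def conj_commute)
    have A_events [measurable]: "A n \<in> events" for n using A_past F_events by blast
    \<comment> \<open>The width contributes \<open>\<kappa> * (r / 2)\<close>, and the passage from
      \<open>G\<close> to \<open>H\<close> another factor one half.\<close>
    have hit: "\<kappa> * r / 4 * prob G \<le> prob (G \<inter> (\<Union>k\<in>{n<..}. A k))" if G: "G \<in> sets (past n)" for n G
    proof -
      have [measurable]: "G \<in> events" using G F_events by blast
      obtain H R where H_past: "H \<in> sets (past n)" and H: "H \<subseteq> G" "H \<subseteq> {\<omega>. \<bar>S n \<omega>\<bar> \<le> R}"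
        and half: "prob G / 2 \<le> prob H"
        by (rule past_bounded_part[OF G])
      have [measurable]: "H \<in> events" using H_past F_events by blast
      have "eventually (\<lambda>k. n < k \<and> R \<le> r / 2 * real (k - n) powr (1 / \<alpha>)) sequentially"
        using pos by (intro eventually_conj eventually_gt_at_top eventually_time_large) auto
      then obtain k where k: "n < k" "R \<le> r / 2 * real (k - n) powr (1 / \<alpha>)"
        by (auto simp: eventually_sequentially)
      define \<rho> where "\<rho> = real (k - n) powr (1 / \<alpha>)"
      have \<rho>: "0 < \<rho>" using k by (simp add: \<rho>_def)
      obtain u v where uv: "{u<..v} \<subseteq> J" "v - u = r / 2 * \<rho>" "\<bar>u\<bar> \<le> r / 2 * \<rho>" "\<bar>v\<bar> \<le> r / 2 * \<rho>"
        using wide[of "r / 2 * \<rho>"] pos \<rho> by auto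
      have "u \<le> v" using uv(2) pos \<rho> by (smt (verit) mult_pos_pos half_gt_zero)
      then have "prob H * (\<kappa> * ((v - u) / \<rho>)) \<le> prob (H \<inter> {\<omega> \<in> space M. S k \<omega> \<in> {u<..v}})"
        using k uv unfolding \<rho>_def
        by (intro lower[OF k(1) _ H_past H(2)]) auto
      also have "\<dots> \<le> prob (G \<inter> (\<Union>k\<in>{n<..}. A k))"
      proof (rule finite_measure_mono)
        show "H \<inter> {\<omega> \<in> space M. S k \<omega> \<in> {u<..v}} \<subseteq> G \<inter> (\<Union>k\<in>{n<..}. A k)"
          using uv(1) k(1) H(1) by (auto simp: A_def)
      qed measurable
      finally have "prob H * (\<kappa> * (r / 2)) \<le> prob (G \<inter> (\<Union>k\<in>{n<..}. A k))"
        unfolding uv(2) using \<rho> by simp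
      moreover have "prob G / 2 * (\<kappa> * (r / 2)) \<le> prob H * (\<kappa> * (r / 2))"
        using half pos by (intro mult_right_mono) auto
      ultimately show ?thesis by (simp add: mult_ac)
    qed
    have "AE \<omega> in M. infinite {n. \<omega> \<in> A n}"
      by (rule AE_infinitely_often[OF A_past _ hit]) (use pos in auto)
    then show ?thesis
      by (rule AE_mp, intro AE_I2 impI) (simp add: A_def)
  qed
  have "AE \<omega> in M. infinite {n. S n \<omega> \<in> {0<..}}"
  proof (rule sign)
    show "\<exists>u v. {u<..v} \<subseteq> {0<..} \<and> v - u = w \<and> \<bar>u\<bar> \<le> w \<and> \<bar>v\<bar> \<le> w" if "0 < w" for w :: real
      using that by (intro exI[of _ 0] exI[of _ w]) auto
  qed simp
  then show "AE \<omega> in M. infinite {n. 0 < S n \<omega>}" by simp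
  have "AE \<omega> in M. infinite {n. S n \<omega> \<in> {..0}}"
  proof (rule sign)
    show "\<exists>u v. {u<..v} \<subseteq> {..0} \<and> v - u = w \<and> \<bar>u\<bar> \<le> w \<and> \<bar>v\<bar> \<le> w" if "0 < w" for w :: real
      using that by (intro exI[of _ "-w"] exI[of _ 0]) auto
  qed simp
  then show "AE \<omega> in M. infinite {n. S n \<omega> \<le> 0}" by simp
qed

lemma AE_eventually_large:
  assumes \<epsilon>: "1 - 1 / \<alpha> < \<epsilon>" and K: "0 < K"
  shows "AE \<omega> in M. eventually (\<lambda>n. K < \<bar>real n powr \<epsilon> * S n \<omega>\<bar>) sequentially"
proof -
  obtain C :: real where pos: "0 < C"
    and upper: "\<And>j k u v H. \<lbrakk>j < k; u \<le> v; H \<in> sets (past j)\<rbrakk>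
      \<Longrightarrow> prob (H \<inter> {\<omega> \<in> space M. S k \<omega> \<in> {u<..v}}) \<le> prob H * (C * ((v - u) / real (k - j) powr (1 / \<alpha>)))"
    by (rule prob_increment_le) blast
  define A where "A = (\<lambda>n. {\<omega> \<in> space M. \<bar>real n powr \<epsilon> * S n \<omega>\<bar> \<le> K})"
  have A_events [measurable]: "A n \<in> events" for n unfolding A_def by measurable
  have bound: "prob (A k) \<le> C * (3 * K) * real k powr - (\<epsilon> + 1 / \<alpha>)" if k: "1 \<le> k" for k
  proof -
    define h where "h = K / real k powr \<epsilon>"
    have h: "0 < h" using K k by (simp add: h_def)
    \<comment> \<open>The left endpoint \<open>- 2 * h\<close> makes the half-open interval contain
      \<open>- h\<close>; its length \<open>3 * h\<close> accounts for the factor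
      \<open>3 * K\<close>. The increment bound is then used from time 0 with the whole space as
      past event.\<close>
    have "prob (A k) \<le> prob (space M \<inter> {\<omega> \<in> space M. S k \<omega> \<in> {- 2 * h<..h}})"
    proof (rule finite_measure_mono)
      show "A k \<subseteq> space M \<inter> {\<omega> \<in> space M. S k \<omega> \<in> {- 2 * h<..h}}"
      proof
        fix \<omega> assume "\<omega> \<in> A k"
        then have \<omega>: "\<omega> \<in> space M" "\<bar>S k \<omega>\<bar> \<le> h"
          using k by (auto simp: A_def h_def abs_mult field_simps)
        then show "\<omega> \<in> space M \<inter> {\<omega> \<in> space M. S k \<omega> \<in> {- 2 * h<..h}}" using h by auto
      qed
    qed measurable
    also have "\<dots> \<le> prob (space M) * (C * ((h - (- 2 * h)) / real (k - 0) powr (1 / \<alpha>)))"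
      using k h sets.top[of "past 0"] by (intro upper) auto
    also have "\<dots> = C * (3 * K) * real k powr - (\<epsilon> + 1 / \<alpha>)"
      using k unfolding powr_minus powr_add by (simp add: prob_space h_def field_simps)
    finally show ?thesis .
  qed
  have "summable (\<lambda>k. prob (A k))"
  proof (rule summable_comparison_test')
    show "summable (\<lambda>k. C * (3 * K) * real k powr - (\<epsilon> + 1 / \<alpha>))"
      using \<epsilon> by (intro summable_mult) (simp add: summable_real_powr_iff)
    show "norm (prob (A k)) \<le> C * (3 * K) * real k powr - (\<epsilon> + 1 / \<alpha>)" if "1 \<le> k" for k
      using bound[OF that] by simp
  qed
  then have "AE \<omega> in M. eventually (\<lambda>n. \<omega> \<in> space M - A n) sequentially"
    by (intro borel_cantelli_AE1) (auto simp: emeasure_eq_measure)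
  then show ?thesis
    by (rule AE_mp, intro AE_I2 impI) (auto simp: A_def not_le elim: eventually_mono)
qed

section \<open>From visits and escape to accumulation points\<close>

lemma AE_accum_pts_UNIV:
  assumes "0 \<le> \<epsilon>" "\<epsilon> \<le> 1 - 1 / \<alpha>"
  shows "AE \<omega> in M. accum_pts (\<lambda>n. real n powr \<epsilon> * S n \<omega>) = UNIV"
proof -
  have "AE \<omega> in M. \<forall>q\<in>\<rat>. \<forall>m. infinite {n. real n powr \<epsilon> * S n \<omega> \<in> {q - 1 / real (Suc m)<..q + 1 / real (Suc m)}}"
    unfolding AE_ball_countable[OF countable_rat] AE_all_countable
    using AE_hits_target[OF assms] by simp
  then show ?thesis
    by eventually_elim (rule accum_pts_eq_UNIV, blast)
qed

lemma AE_accum_pts_infinities: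
  assumes "1 - 1 / \<alpha> < \<epsilon>"
  shows "AE \<omega> in M. accum_pts (\<lambda>n. real n powr \<epsilon> * S n \<omega>) = {-\<infinity>, \<infinity>}"
proof -
  \<comment> \<open>Thresholds \<open>real (Suc K)\<close> are countably many and positive, as
    \<open>AE_eventually_large\<close> demands.\<close>
  have "AE \<omega> in M. \<forall>K::nat. eventually (\<lambda>n. real (Suc K) < \<bar>real n powr \<epsilon> * S n \<omega>\<bar>) sequentially"
    unfolding AE_all_countable using AE_eventually_large[OF assms] by simp
  with AE_both_signs show ?thesis
  proof eventually_elim
    case (elim \<omega>)
    show ?case
    proof (rule accum_pts_eq_infinities)
      show "eventually (\<lambda>n. real K < \<bar>real n powr \<epsilon> * S n \<omega>\<bar>) sequentially" for K
        using elim(3)[rule_format, of K] by (auto elim: eventually_mono)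
      have "{n. 0 < S n \<omega>} \<subseteq> {n. 0 < real n powr \<epsilon> * S n \<omega>}"
      proof safe
        fix n assume "0 < S n \<omega>"
        \<comment> \<open>\<open>S 0\<close> is an empty sum, and
          \<open>0 powr \<epsilon> = 0\<close> would destroy strict positivity.\<close>
        moreover from this have "n \<noteq> 0" by (intro notI) (simp add: S_def)
        ultimately show "0 < real n powr \<epsilon> * S n \<omega>" by simp
      qed
      then show "infinite {n. 0 < real n powr \<epsilon> * S n \<omega>}" using elim(1) finite_subset by blast
      have "{n. S n \<omega> \<le> 0} \<subseteq> {n. real n powr \<epsilon> * S n \<omega> \<le> 0}"
        by (auto intro: mult_nonneg_nonpos)
      then show "infinite {n. real n powr \<epsilon> * S n \<omega> \<le> 0}" using elim(2) finite_subset by blast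
    qed
  qed
qed

end

theorem corollary1:
  fixes M :: "'a measure" and X :: "nat \<Rightarrow> 'a \<Rightarrow> real" and S :: "nat \<Rightarrow> 'a \<Rightarrow> real"
    and \<alpha> c \<epsilon> :: real
  assumes "prob_space M"
    and "1 \<le> \<alpha>" and "\<alpha> \<le> 2" and "0 < c"
    and "prob_space.indep_vars M (\<lambda>_. borel) X {1..}"
    and "\<And>i t. 1 \<le> i \<Longrightarrow>
          char (distr M borel (X i)) t = complex_of_real (exp (- c * \<bar>t\<bar> powr \<alpha>))"
    and "\<And>n \<omega>. S n \<omega> = (\<Sum>i = 1..n. X i \<omega>)"
    and "0 \<le> \<epsilon>"
  shows "(\<epsilon> \<le> 1 - 1 / \<alpha> \<longrightarrow>
            (AE \<omega> in M. accum_pts (\<lambda>n. real n powr \<epsilon> * S n \<omega>) = UNIV)) \<and>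
         (\<epsilon> > 1 - 1 / \<alpha> \<longrightarrow>
            (AE \<omega> in M. accum_pts (\<lambda>n. real n powr \<epsilon> * S n \<omega>) = {-\<infinity>, \<infinity>}))"
proof -
  interpret W: stable_walk M X \<alpha> c
    unfolding stable_walk_def stable_walk_axioms_def using assms by simp
  have "S = W.S" using assms(7) by (intro ext) (simp add: W.S_def)
  then show ?thesis
    using W.AE_accum_pts_UNIV[of \<epsilon>] W.AE_accum_pts_infinities[of \<epsilon>] \<open>0 \<le> \<epsilon>\<close> by simp
qed

end
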